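(* Let $s\in(0,1]$, and let the entries of the $m\times n$ matrix $X_n$ (with $m=\lfloor n^s\rfloor$) be i.i.d. sub-Gaussian random variables with mean $0$ and unit variance (with a common distribution not depending on $n$). Fix $\alpha>2s$ and $\varepsilon>0$. Then as $n\to\infty$, $$\mathbb{P}\left(\lambda_1(B_{n,\alpha,s})\le 1-\varepsilon\right)\to 0,\qquad \mathbb{P}\left(\lambda_m(B_{n,\alpha,s})\ge 1+\varepsilon\right)\to 0.$$
   Context: Let $m=\lfloor n^s\rfloor$. For the $m\times n$ random matrix $X_n$, define the $m\times m$ matrix $A_{n,s}=\frac{X_nX_n^T}{n}$, and let $B_{n,\alpha,s}$ be the matrix obtained by applying $x\mapsto |x|^\alpha$ to each entry of $A_{n,s}$, i.e. $(B_{n,\alpha,s})_{ij}=|(A_{n,s})_{ij}|^\alpha$. $\lambda_1(A)$ and $\lambda_m(A)$ denote respectively the smallest and largest eigenvalues of a symmetric $m\times m$ matrix $A$. *)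

theory Defs
  imports
    "HOL-Probability.Probability"
    "Jordan_Normal_Form.Spectral_Radius"
begin

(* The tail form of the sub-Gaussian property; the constant 2 is the usual
   normalisation, any other constant > 1 defines the same class of variables. *)
definition sub_gaussian :: "'a measure \<Rightarrow> ('a \<Rightarrow> real) \<Rightarrow> bool" where
  "sub_gaussian M Y \<longleftrightarrow>
     (\<exists>K>0. \<forall>t\<ge>0. measure M {\<omega> \<in> space M. \<bar>Y \<omega>\<bar> \<ge> t} \<le> 2 * exp (- (t\<^sup>2 / K\<^sup>2)))"

definition row_dim :: "real \<Rightarrow> nat \<Rightarrow> nat" where
  "row_dim s n = nat \<lfloor>real n powr s\<rfloor>"

definition sample_cov :: "nat \<Rightarrow> real mat \<Rightarrow> real mat" where
  "sample_cov n X = (1 / real n) \<cdot>\<^sub>m (X * transpose_mat X)"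

definition abs_powr_mat :: "real \<Rightarrow> real mat \<Rightarrow> real mat" where
  "abs_powr_mat \<alpha> A = map_mat (\<lambda>x. \<bar>x\<bar> powr \<alpha>) A"

(* Meant for symmetric matrices of positive dimension: their spectrum is finite,
   non-empty and real.  On 0 x 0 matrices the values are unspecified. *)
definition min_eigenvalue :: "real mat \<Rightarrow> real" where
  "min_eigenvalue A = Min (spectrum A)"

definition max_eigenvalue :: "real mat \<Rightarrow> real" where
  "max_eigenvalue A = Max (spectrum A)"

end

theory Submission
  imports Defs "HOL-Real_Asymp.Real_Asymp"
begin

text \<open>
  By Gershgorin's theorem it suffices that the diagonal entries of the transformed matrix are close
  to 1 and that its off-diagonal row sums are small.  An entry of the sample covariance matrix minus
  its mean is a normalised sum of \<open>n\<close> independent centred variables with a uniform exponential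
  moment (products or squares of sub-Gaussians), so a Chernoff bound with parameter \<open>1 / sqrt n\<close>
  shows that it exceeds \<open>a / sqrt n\<close> with probability \<open>O(exp (- a))\<close>.  A row sum is at most
  \<open>n powr s\<close> times the maximal entry to the power \<open>\<alpha>\<close>, so off-diagonal entries of size
  \<open>n powr (- s / \<alpha>)\<close> times a small constant are harmless; as \<open>s / \<alpha> < 1 / 2\<close>, larger ones occur with
  probability \<open>O(exp (- \<kappa> * n powr \<gamma>))\<close> for some positive \<open>\<kappa>\<close> and \<open>\<gamma>\<close>, which survives the union
  bound over at most \<open>n\<^sup>2\<close> entries.
\<close>

section \<open>Moment generating functions and Chernoff bounds for independent sums\<close>

lemma exp_le_one_plus_square_exp:
  fixes x :: real
  shows "exp x \<le> 1 + x + x\<^sup>2 / 2 * exp \<bar>x\<bar>"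
proof -
  obtain t where t: "\<bar>t\<bar> \<le> \<bar>x\<bar>"
    and eq: "exp x = (\<Sum>m<2. (x ^ m) / fact m) + (exp t / fact 2) * x ^ 2"
    using Maclaurin_exp_le[of x 2] by blast
  have "exp t \<le> exp \<bar>x\<bar>" using t by simp
  hence "(exp t / fact 2) * x ^ 2 \<le> (exp \<bar>x\<bar> / fact 2) * x ^ 2"
    by (intro mult_right_mono divide_right_mono) auto
  thus ?thesis unfolding eq by (simp add: eval_nat_numeral algebra_simps)
qed

text \<open>The quadratic term of the exponential series at \<open>c / 2 * \<bar>z\<bar>\<close>
  already suffices. This trades exponential rate \<open>c / 2\<close> for a factor
  \<open>z\<^sup>2\<close>.\<close>

lemma square_le_exp_abs:
  fixes z c :: real
  assumes "c > 0"
  shows "z\<^sup>2 / 2 \<le> 4 / c\<^sup>2 * exp (c / 2 * \<bar>z\<bar>)"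
proof -
  have "1 + c / 2 * \<bar>z\<bar> + (c / 2 * \<bar>z\<bar>)\<^sup>2 / 2 \<le> exp (c / 2 * \<bar>z\<bar>)"
    using assms by (intro exp_lower_Taylor_quadratic) auto
  hence "(c / 2 * \<bar>z\<bar>)\<^sup>2 / 2 \<le> exp (c / 2 * \<bar>z\<bar>)"
    using assms by (smt (verit) mult_nonneg_nonneg abs_ge_zero divide_nonneg_nonneg)
  hence "c\<^sup>2 * z\<^sup>2 / 8 \<le> exp (c / 2 * \<bar>z\<bar>)"
    by (simp add: power_mult_distrib power_divide)
  thus ?thesis using assms by (simp add: field_simps)
qed

text \<open>The linear Taylor term vanishes because the mean is 0. The remainder is at most a
  multiple of \<open>exp (c * \<bar>Z \<omega>\<bar>)\<close>: half of the rate \<open>c\<close>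
  absorbs the square, the other half absorbs \<open>exp \<bar>l * Z \<omega>\<bar>\<close>, hence
  the restriction on \<open>l\<close>.\<close>

lemma (in prob_space) mgf_le_exp_square:
  fixes Z :: "'a \<Rightarrow> real"
  assumes Z [measurable]: "Z \<in> borel_measurable M"
    and c: "c > 0"
    and int: "integrable M (\<lambda>\<omega>. exp (c * \<bar>Z \<omega>\<bar>))"
    and D: "expectation (\<lambda>\<omega>. exp (c * \<bar>Z \<omega>\<bar>)) \<le> D"
    and mean: "expectation Z = 0"
    and l: "\<bar>l\<bar> \<le> c / 2"
  shows "integrable M (\<lambda>\<omega>. exp (l * Z \<omega>))"
    and "expectation (\<lambda>\<omega>. exp (l * Z \<omega>)) \<le> exp (4 * D / c\<^sup>2 * l\<^sup>2)"
proof -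
  have le: "exp (l * Z \<omega>) \<le> exp (c * \<bar>Z \<omega>\<bar>)" for \<omega>
  proof -
    have "l * Z \<omega> \<le> \<bar>l\<bar> * \<bar>Z \<omega>\<bar>" by (metis abs_ge_self abs_mult)
    also have "\<dots> \<le> c * \<bar>Z \<omega>\<bar>" using l c by (intro mult_right_mono) auto
    finally show ?thesis by simp
  qed
  show int_l: "integrable M (\<lambda>\<omega>. exp (l * Z \<omega>))"
    by (rule Bochner_Integration.integrable_bound[OF int]) (use le in \<open>auto intro!: AE_I2\<close>)
  have intZ: "integrable M Z"
  proof (rule Bochner_Integration.integrable_bound)
    show "integrable M (\<lambda>\<omega>. exp (c * \<bar>Z \<omega>\<bar>) / c)" using int by simp
    have "\<bar>Z \<omega>\<bar> \<le> exp (c * \<bar>Z \<omega>\<bar>) / c" for \<omega>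
    proof -
      have "c * \<bar>Z \<omega>\<bar> \<le> exp (c * \<bar>Z \<omega>\<bar>)" using exp_ge_add_one_self[of "c * \<bar>Z \<omega>\<bar>"] by linarith
      thus ?thesis using c by (simp add: field_simps)
    qed
    thus "AE \<omega> in M. norm (Z \<omega>) \<le> norm (exp (c * \<bar>Z \<omega>\<bar>) / c)" using c by simp
  qed simp
  have bound: "exp (l * Z \<omega>) \<le> 1 + l * Z \<omega> + 4 / c\<^sup>2 * l\<^sup>2 * exp (c * \<bar>Z \<omega>\<bar>)" for \<omega>
  proof -
    have "exp \<bar>l * Z \<omega>\<bar> \<le> exp (c / 2 * \<bar>Z \<omega>\<bar>)"
      unfolding exp_le_cancel_iff abs_mult using l by (intro mult_right_mono) auto
    hence "(l * Z \<omega>)\<^sup>2 / 2 * exp \<bar>l * Z \<omega>\<bar> \<le> l\<^sup>2 * ((Z \<omega>)\<^sup>2 / 2) * exp (c / 2 * \<bar>Z \<omega>\<bar>)"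
      by (auto simp: power_mult_distrib intro!: mult_left_mono)
    also have "\<dots> \<le> l\<^sup>2 * (4 / c\<^sup>2 * exp (c / 2 * \<bar>Z \<omega>\<bar>)) * exp (c / 2 * \<bar>Z \<omega>\<bar>)"
      by (intro mult_right_mono mult_left_mono square_le_exp_abs c) auto
    also have "\<dots> = 4 / c\<^sup>2 * l\<^sup>2 * exp (c * \<bar>Z \<omega>\<bar>)"
      by (simp add: mult_exp_exp)
    finally show ?thesis using exp_le_one_plus_square_exp[of "l * Z \<omega>"] by linarith
  qed
  have "expectation (\<lambda>\<omega>. exp (l * Z \<omega>))
      \<le> expectation (\<lambda>\<omega>. 1 + l * Z \<omega> + 4 / c\<^sup>2 * l\<^sup>2 * exp (c * \<bar>Z \<omega>\<bar>))"
    using int int_l intZ bound by (intro integral_mono) auto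
  also have "\<dots> = 1 + 4 / c\<^sup>2 * l\<^sup>2 * expectation (\<lambda>\<omega>. exp (c * \<bar>Z \<omega>\<bar>))"
    using int intZ mean by (simp add: prob_space)
  also have "\<dots> \<le> 1 + 4 / c\<^sup>2 * l\<^sup>2 * D"
    using D by (intro add_left_mono mult_left_mono) auto
  also have "\<dots> \<le> exp (4 * D / c\<^sup>2 * l\<^sup>2)"
    using exp_ge_add_one_self[of "4 * D / c\<^sup>2 * l\<^sup>2"] by (simp add: field_simps)
  finally show "expectation (\<lambda>\<omega>. exp (l * Z \<omega>)) \<le> exp (4 * D / c\<^sup>2 * l\<^sup>2)" .
qed

text \<open>Markov's inequality for the exponential of the sum divided by \<open>sqrt n\<close>. By
  independence its expectation is a product of \<open>n\<close> factors, each at most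
  \<open>exp (C / n)\<close>, so it stays below \<open>exp C\<close>.\<close>

lemma (in prob_space) indep_sum_upper_tail:
  fixes Z :: "nat \<Rightarrow> 'a \<Rightarrow> real"
  assumes indep: "indep_vars (\<lambda>_. borel) Z {..<n}"
    and n: "n > 0"
    and int: "\<And>k. k < n \<Longrightarrow> integrable M (\<lambda>\<omega>. exp (Z k \<omega> / sqrt n))"
    and le: "\<And>k. k < n \<Longrightarrow> expectation (\<lambda>\<omega>. exp (Z k \<omega> / sqrt n)) \<le> exp (C / n)"
  shows "prob {\<omega> \<in> space M. (\<Sum>k<n. Z k \<omega>) \<ge> a * sqrt n} \<le> exp (C - a)"
proof -
  have Z [measurable]: "Z k \<in> borel_measurable M" if "k < n" for k
    using indep that by (auto simp: indep_vars_def)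
  have S [measurable]: "(\<lambda>\<omega>. \<Sum>k<n. Z k \<omega>) \<in> borel_measurable M" by measurable
  have ind: "indep_vars (\<lambda>_. borel) (\<lambda>k \<omega>. exp (Z k \<omega> / sqrt n)) {..<n}"
    by (rule indep_vars_compose2[OF indep]) simp
  have prod: "exp ((\<Sum>k<n. Z k \<omega>) / sqrt n) = (\<Prod>k<n. exp (Z k \<omega> / sqrt n))" for \<omega>
    by (simp add: exp_sum sum_divide_distrib)
  have intp: "integrable M (\<lambda>\<omega>. exp ((\<Sum>k<n. Z k \<omega>) / sqrt n))"
    unfolding prod using int by (intro indep_vars_integrable ind) auto
  have "expectation (\<lambda>\<omega>. exp ((\<Sum>k<n. Z k \<omega>) / sqrt n))
      = (\<Prod>k<n. expectation (\<lambda>\<omega>. exp (Z k \<omega> / sqrt n)))"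
    unfolding prod using int by (intro indep_vars_lebesgue_integral ind) auto
  also have "\<dots> \<le> (\<Prod>k<n. exp (C / n))"
    using le by (intro prod_mono) auto
  also have "\<dots> = exp C" using n by (simp flip: exp_of_nat_mult)
  finally have E: "expectation (\<lambda>\<omega>. exp ((\<Sum>k<n. Z k \<omega>) / sqrt n)) \<le> exp C" .
  have "{\<omega> \<in> space M. (\<Sum>k<n. Z k \<omega>) \<ge> a * sqrt n}
      = {\<omega> \<in> space M. exp ((\<Sum>k<n. Z k \<omega>) / sqrt n) \<ge> exp a}"
    using n by (auto simp: field_simps)
  also have "prob \<dots> \<le> expectation (\<lambda>\<omega>. exp ((\<Sum>k<n. Z k \<omega>) / sqrt n)) / exp a"
    by (rule integral_Markov_inequality_measure[OF intp]) auto
  also have "\<dots> \<le> exp C / exp a" using E by (intro divide_right_mono) auto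
  finally show ?thesis by (simp add: exp_diff)
qed

lemma (in prob_space) indep_sum_tail:
  fixes Z :: "nat \<Rightarrow> 'a \<Rightarrow> real"
  assumes indep: "indep_vars (\<lambda>_. borel) Z {..<n}"
    and c: "c > 0"
    and n: "real n \<ge> 4 / c\<^sup>2"
    and int: "\<And>k. k < n \<Longrightarrow> integrable M (\<lambda>\<omega>. exp (c * \<bar>Z k \<omega>\<bar>))"
    and D: "\<And>k. k < n \<Longrightarrow> expectation (\<lambda>\<omega>. exp (c * \<bar>Z k \<omega>\<bar>)) \<le> D"
    and mean: "\<And>k. k < n \<Longrightarrow> expectation (Z k) = 0"
  shows "prob {\<omega> \<in> space M. \<bar>\<Sum>k<n. Z k \<omega>\<bar> \<ge> a * sqrt n} \<le> 2 * exp (4 * D / c\<^sup>2) * exp (- a)"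
proof -
  have Z [measurable]: "Z k \<in> borel_measurable M" if "k < n" for k
    using indep that by (auto simp: indep_vars_def)
  have n0: "n > 0" using n c by (cases n) (auto simp: field_simps)
  \<comment> \<open>The lower bound on \<open>n\<close> is what admits the Chernoff parameter
    \<open>1 / sqrt n\<close> in \<open>mgf_le_exp_square\<close>, which asks for at most
    \<open>c / 2\<close>.\<close>
  have "2 / c \<le> sqrt n" using n c by (intro real_le_rsqrt) (simp add: power_divide)
  hence l: "\<bar>1 / sqrt n\<bar> \<le> c / 2" using c n0 by (simp add: field_simps)
  \<comment> \<open>Stated for any \<open>Y\<close> with the same absolute values as
    \<open>Z\<close>, so that it serves both \<open>Z\<close> and its negative: the moment bounds on
    \<open>\<bar>Z k \<omega>\<bar>\<close> do not see the sign.\<close>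
  have upper: "prob {\<omega> \<in> space M. (\<Sum>k<n. Y k \<omega>) \<ge> a * sqrt n} \<le> exp (4 * D / c\<^sup>2 - a)"
    if Y: "indep_vars (\<lambda>_. borel) Y {..<n}"
      "\<And>k \<omega>. \<bar>Y k \<omega>\<bar> = \<bar>Z k \<omega>\<bar>" "\<And>k. k < n \<Longrightarrow> expectation (Y k) = 0" for Y
  proof (rule indep_sum_upper_tail[OF Y(1) n0])
    fix k assume k: "k < n"
    have m: "Y k \<in> borel_measurable M" using Y(1) k by (auto simp: indep_vars_def)
    note mgf = mgf_le_exp_square[where Z = "Y k" and l = "1 / sqrt n", OF m c _ _ Y(3)[OF k] l,
        unfolded Y(2), OF int[OF k] D[OF k]]
    show "integrable M (\<lambda>\<omega>. exp (Y k \<omega> / sqrt n))" using mgf(1) by simp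
    show "expectation (\<lambda>\<omega>. exp (Y k \<omega> / sqrt n)) \<le> exp (4 * D / c\<^sup>2 / n)"
      using mgf(2) by (simp add: power_divide)
  qed
  have neg: "indep_vars (\<lambda>_. borel) (\<lambda>k \<omega>. - Z k \<omega>) {..<n}"
    by (rule indep_vars_compose2[OF indep]) simp
  have "prob {\<omega> \<in> space M. \<bar>\<Sum>k<n. Z k \<omega>\<bar> \<ge> a * sqrt n}
      \<le> prob ({\<omega> \<in> space M. (\<Sum>k<n. Z k \<omega>) \<ge> a * sqrt n}
             \<union> {\<omega> \<in> space M. (\<Sum>k<n. - Z k \<omega>) \<ge> a * sqrt n})"
    by (rule finite_measure_mono) (auto simp: sum_negf)
  also have "\<dots> \<le> prob {\<omega> \<in> space M. (\<Sum>k<n. Z k \<omega>) \<ge> a * sqrt n}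
             + prob {\<omega> \<in> space M. (\<Sum>k<n. - Z k \<omega>) \<ge> a * sqrt n}"
    by (rule measure_Un_le) auto
  also have "\<dots> \<le> exp (4 * D / c\<^sup>2 - a) + exp (4 * D / c\<^sup>2 - a)"
    using mean by (intro add_mono upper indep neg) auto
  finally show ?thesis by (simp add: exp_diff exp_minus field_simps)
qed

section \<open>Square-exponential moments from sub-Gaussian tails\<close>

text \<open>The real line is cut according to the integer part of \<open>x\<^sup>2\<close>; on each
  piece the tail bound beats the exponential weight, and a geometric series remains.\<close>

lemma sub_gaussian_exp_square_integrable:
  assumes law: "real_distribution \<mu>" and sg: "sub_gaussian \<mu> (\<lambda>x. x)"
  shows "\<exists>c>0. integrable \<mu> (\<lambda>x. exp (c * x\<^sup>2))"
proof -
  interpret real_distribution \<mu> by fact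
  obtain K where K: "K > 0"
    and tail: "\<And>t. t \<ge> 0 \<Longrightarrow> prob {x \<in> space \<mu>. \<bar>x\<bar> \<ge> t} \<le> 2 * exp (- (t\<^sup>2 / K\<^sup>2))"
    using sg unfolding sub_gaussian_def by blast
  \<comment> \<open>Half the rate of the tail bound: the weight \<open>exp (c * n)\<close> against
    the tail \<open>2 * exp (- 2 * c * n)\<close> leaves the ratio \<open>exp (- c)\<close>.\<close>
  define c where "c = 1 / (2 * K\<^sup>2)"
  have c: "c > 0" using K by (simp add: c_def)
  define S where "S n = {x \<in> space \<mu>. \<bar>x\<bar> \<ge> sqrt (real n)}" for n
  have S [measurable]: "S n \<in> sets \<mu>" for n unfolding S_def by measurable
  have point: "ennreal (exp (c * x\<^sup>2)) \<le> (\<Sum>n. ennreal (exp (c * (real n + 1))) * indicator (S n) x)"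
    if "x \<in> space \<mu>" for x
  proof -
    \<comment> \<open>The summand with this index alone dominates, since \<open>x\<close> lies in
      \<open>S n\<close> and \<open>x\<^sup>2\<close> is at most \<open>n + 1\<close>.\<close>
    define n where "n = nat \<lfloor>x\<^sup>2\<rfloor>"
    have n: "real n \<le> x\<^sup>2" "x\<^sup>2 \<le> real n + 1" unfolding n_def by (simp_all add: of_nat_nat)
    have "x \<in> S n" unfolding S_def using that n(1) by (auto intro!: real_le_lsqrt simp: real_le_lsqrt)
    hence "ennreal (exp (c * x\<^sup>2)) \<le> ennreal (exp (c * (real n + 1))) * indicator (S n) x"
      using n c by (auto intro!: ennreal_leI)
    moreover define f where "f k = ennreal (exp (c * (real k + 1))) * indicator (S k) x" for k
    moreover have "f n \<le> (\<Sum>k. f k)" using sum_le_suminf[OF summableI, of "{n}" f] by simp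
    ultimately show ?thesis by (simp only: f_def)
  qed
  have tail_term: "ennreal (exp (c * (real n + 1))) * emeasure \<mu> (S n) \<le> ennreal (2 * exp c * exp (- c) ^ n)" for n
  proof -
    have "exp (c * (real n + 1)) * prob (S n) \<le> exp (c * (real n + 1)) * (2 * exp (- (2 * c * real n)))"
      using tail[of "sqrt (real n)"] unfolding S_def
      by (intro mult_left_mono) (auto simp: c_def)
    also have "\<dots> = 2 * exp c * exp (- c) ^ n"
      by (simp flip: exp_of_nat_mult) (simp add: mult_exp_exp algebra_simps)
    finally show ?thesis
      by (simp add: emeasure_eq_measure ennreal_mult[symmetric] ennreal_leI)
  qed
  have summ: "summable (\<lambda>n. 2 * exp c * exp (- c) ^ n)"
    using c by (intro summable_mult summable_geometric) auto
  have "(\<integral>\<^sup>+x. ennreal (exp (c * x\<^sup>2)) \<partial>\<mu>)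
      \<le> (\<integral>\<^sup>+x. (\<Sum>n. ennreal (exp (c * (real n + 1))) * indicator (S n) x) \<partial>\<mu>)"
    by (intro nn_integral_mono point)
  also have "\<dots> = (\<Sum>n. ennreal (exp (c * (real n + 1))) * emeasure \<mu> (S n))"
  proof (subst nn_integral_suminf)
    show "(\<Sum>n. \<integral>\<^sup>+x. ennreal (exp (c * (real n + 1))) * indicator (S n) x \<partial>\<mu>)
        = (\<Sum>n. ennreal (exp (c * (real n + 1))) * emeasure \<mu> (S n))"
      by (subst nn_integral_cmult_indicator) (use S in auto)
  qed measurable
  also have "\<dots> \<le> (\<Sum>n. ennreal (2 * exp c * exp (- c) ^ n))"
    by (intro suminf_le tail_term) auto
  also have "\<dots> = ennreal (\<Sum>n. 2 * exp c * exp (- c) ^ n)"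
    using summ by (intro suminf_ennreal2) auto
  also have "\<dots> < \<infinity>" by simp
  finally have "integrable \<mu> (\<lambda>x. exp (c * x\<^sup>2))"
    by (intro integrableI_nonneg) auto
  thus ?thesis using c by blast
qed

section \<open>Spectra of real symmetric matrices and Gershgorin's theorem\<close>

text \<open>The Hermitian form \<open>Q\<close> at an eigenvector equals \<open>k\<close> times the
  squared norm \<open>N\<close>. Symmetry makes \<open>Q\<close> its own conjugate, and
  \<open>N\<close> is nonzero.\<close>

lemma symmetric_complex_eigenvalue_real:
  fixes A :: "real mat" and k :: complex
  assumes A: "A \<in> carrier_mat m m"
    and sym: "\<And>i j. i < m \<Longrightarrow> j < m \<Longrightarrow> A $$ (i, j) = A $$ (j, i)"
    and ev: "eigenvalue (map_mat complex_of_real A) k"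
  shows "k \<in> \<real>"
proof -
  obtain v where v: "v \<in> carrier_vec m" "v \<noteq> 0\<^sub>v m"
    and eq: "map_mat complex_of_real A *\<^sub>v v = k \<cdot>\<^sub>v v"
    using ev A unfolding eigenvalue_def eigenvector_def by auto
  have row: "(\<Sum>j<m. complex_of_real (A $$ (i, j)) * v $ j) = k * v $ i" if "i < m" for i
  proof -
    have "(map_mat complex_of_real A *\<^sub>v v) $ i = (k \<cdot>\<^sub>v v) $ i" by (simp add: eq)
    thus ?thesis using that A v(1) by (auto simp: scalar_prod_def lessThan_atLeast0)
  qed
  define Q where "Q = (\<Sum>i<m. \<Sum>j<m. cnj (v $ i) * complex_of_real (A $$ (i, j)) * v $ j)"
  define N where "N = (\<Sum>i<m. (cmod (v $ i))\<^sup>2)"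
  have "Q = (\<Sum>i<m. cnj (v $ i) * (k * v $ i))"
    unfolding Q_def using row by (intro sum.cong) (auto simp: sum_distrib_left[symmetric] mult.assoc)
  also have "\<dots> = k * of_real N"
    unfolding N_def of_real_sum sum_distrib_left
    by (intro sum.cong) (auto simp: complex_norm_square mult_ac simp del: of_real_power)
  finally have QN: "Q = k * of_real N" .
  have "cnj Q = (\<Sum>i<m. \<Sum>j<m. cnj (v $ j) * complex_of_real (A $$ (i, j)) * v $ i)"
    unfolding Q_def by (simp add: mult_ac)
  also have "\<dots> = Q"
    unfolding Q_def by (subst sum.swap, intro sum.cong refl) (auto simp: sym)
  finally have "cnj k * of_real N = k * of_real N"
    unfolding QN by simp
  moreover have "N \<noteq> 0"
  proof
    assume "N = 0"
    hence "v = 0\<^sub>v m" using v(1) unfolding N_def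
      by (intro eq_vecI) (auto simp: sum_nonneg_eq_0_iff)
    with v(2) show False by simp
  qed
  ultimately show ?thesis by (simp add: Reals_cnj_iff)
qed

text \<open>Ensures that \<open>min_eigenvalue\<close> and \<open>max_eigenvalue\<close> are not junk values of \<open>Min\<close> and \<open>Max\<close>.\<close>
lemma symmetric_spectrum_nonempty:
  fixes A :: "real mat"
  assumes A: "A \<in> carrier_mat m m" and m: "m > 0"
    and sym: "\<And>i j. i < m \<Longrightarrow> j < m \<Longrightarrow> A $$ (i, j) = A $$ (j, i)"
  shows "spectrum A \<noteq> {}"
proof -
  let ?B = "map_mat complex_of_real A"
  have B: "?B \<in> carrier_mat m m" using A by simp
  obtain k where k: "eigenvalue ?B k"
    using spectrum_non_empty[OF B m] by (auto simp: spectrum_def)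
  then obtain r where r: "k = complex_of_real r"
    using symmetric_complex_eigenvalue_real[OF A sym] by (auto elim: Reals_cases)
  \<comment> \<open>Embedding the real characteristic polynomial gives the complex one, so a complex
    eigenvalue known to be real is also a root over the reals.\<close>
  have "poly (map_poly complex_of_real (char_poly A)) (complex_of_real r) = 0"
    using k unfolding r eigenvalue_root_char_poly[OF B] of_real_hom.char_poly_hom[OF A] .
  hence "poly (char_poly A) r = 0" by simp
  thus ?thesis using spectrum_root_char_poly[OF A] by auto
qed

text \<open>The row \<open>i\<close> is that of an eigenvector coordinate of largest modulus.
  Isolating the diagonal term in this row of the eigenvalue equation and dividing by
  \<open>\<bar>v $ i\<bar>\<close> leaves weights of at most 1 on the other entries.\<close>

lemma gershgorin:
  fixes A :: "real mat"
  assumes A: "A \<in> carrier_mat m m" and ev: "eigenvalue A k"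
  shows "\<exists>i<m. \<bar>k - A $$ (i, i)\<bar> \<le> (\<Sum>j\<in>{..<m} - {i}. \<bar>A $$ (i, j)\<bar>)"
proof -
  obtain v where v: "v \<in> carrier_vec m" "v \<noteq> 0\<^sub>v m" and eq: "A *\<^sub>v v = k \<cdot>\<^sub>v v"
    using ev A unfolding eigenvalue_def eigenvector_def by auto
  obtain l where l: "l < m" "v $ l \<noteq> 0"
    using v by (metis carrier_vecD eq_vecI index_zero_vec)
  hence "Max ((\<lambda>i. \<bar>v $ i\<bar>) ` {..<m}) \<in> (\<lambda>i. \<bar>v $ i\<bar>) ` {..<m}" by (intro Max_in) auto
  then obtain i where i: "i < m" "\<bar>v $ i\<bar> = Max ((\<lambda>i. \<bar>v $ i\<bar>) ` {..<m})" by auto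
  have max: "\<bar>v $ j\<bar> \<le> \<bar>v $ i\<bar>" if "j < m" for j using that unfolding i(2) by simp
  have pos: "\<bar>v $ i\<bar> > 0" using max[OF l(1)] l(2) by linarith
  have "(A *\<^sub>v v) $ i = (k \<cdot>\<^sub>v v) $ i" by (simp add: eq)
  hence "(\<Sum>j<m. A $$ (i, j) * v $ j) = k * v $ i"
    using i A v(1) by (auto simp: scalar_prod_def lessThan_atLeast0)
  hence "(k - A $$ (i, i)) * v $ i = (\<Sum>j\<in>{..<m} - {i}. A $$ (i, j) * v $ j)"
    using i(1) by (simp add: sum.remove[of _ i] algebra_simps)
  hence "\<bar>k - A $$ (i, i)\<bar> * \<bar>v $ i\<bar> = \<bar>\<Sum>j\<in>{..<m} - {i}. A $$ (i, j) * v $ j\<bar>"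
    by (metis abs_mult)
  also have "\<dots> \<le> (\<Sum>j\<in>{..<m} - {i}. \<bar>A $$ (i, j)\<bar> * \<bar>v $ j\<bar>)"
    by (rule order_trans[OF sum_abs]) (simp add: abs_mult)
  also have "\<dots> \<le> (\<Sum>j\<in>{..<m} - {i}. \<bar>A $$ (i, j)\<bar> * \<bar>v $ i\<bar>)"
    using max by (intro sum_mono mult_left_mono) auto
  also have "\<dots> = (\<Sum>j\<in>{..<m} - {i}. \<bar>A $$ (i, j)\<bar>) * \<bar>v $ i\<bar>" by (simp add: sum_distrib_right)
  finally show ?thesis using pos i(1) by auto
qed

text \<open>Every Gershgorin interval lies within distance \<delta> + m * \<eta> of 1, and
  \<open>Min\<close> and \<open>Max\<close> pick genuine eigenvalues because the spectrum is finite
  and non-empty.\<close>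

lemma eigenvalues_near_one:
  fixes A :: "real mat"
  assumes A: "A \<in> carrier_mat m m" and m: "m > 0"
    and sym: "\<And>i j. i < m \<Longrightarrow> j < m \<Longrightarrow> A $$ (i, j) = A $$ (j, i)"
    and diag: "\<And>i. i < m \<Longrightarrow> \<bar>A $$ (i, i) - 1\<bar> < \<delta>"
    and off: "\<And>i j. i < m \<Longrightarrow> j < m \<Longrightarrow> i \<noteq> j \<Longrightarrow> \<bar>A $$ (i, j)\<bar> \<le> \<eta>"
    and \<eta>: "\<eta> \<ge> 0"
  shows "min_eigenvalue A > 1 - (\<delta> + m * \<eta>)" "max_eigenvalue A < 1 + (\<delta> + m * \<eta>)"
proof -
  have fin: "finite (spectrum A)" by (rule card_finite_spectrum(1)[OF A])
  have ne: "spectrum A \<noteq> {}" by (rule symmetric_spectrum_nonempty[OF A m sym])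
  have near: "\<bar>k - 1\<bar> < \<delta> + m * \<eta>" if "k \<in> spectrum A" for k
  proof -
    obtain i where i: "i < m" "\<bar>k - A $$ (i, i)\<bar> \<le> (\<Sum>j\<in>{..<m} - {i}. \<bar>A $$ (i, j)\<bar>)"
      using gershgorin[OF A, of k] \<open>k \<in> spectrum A\<close> unfolding spectrum_def by auto
    have "(\<Sum>j\<in>{..<m} - {i}. \<bar>A $$ (i, j)\<bar>) \<le> (m - 1) * \<eta>"
      using sum_bounded_above[of "{..<m} - {i}" "\<lambda>j. \<bar>A $$ (i, j)\<bar>" \<eta>] off i(1) by auto
    also have "\<dots> \<le> m * \<eta>"
      using \<eta> by (intro mult_right_mono) auto
    finally show ?thesis using i diag[of i] by linarith
  qed
  show "min_eigenvalue A > 1 - (\<delta> + m * \<eta>)" 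
    using near[OF Min_in[OF fin ne]] unfolding min_eigenvalue_def by linarith
  show "max_eigenvalue A < 1 + (\<delta> + m * \<eta>)"
    using near[OF Max_in[OF fin ne]] unfolding max_eigenvalue_def by linarith
qed

section \<open>Tail bound for the entries of the sample covariance matrix\<close>

text \<open>The inequality of arithmetic and geometric means is used twice: for \<open>x * y\<close>
  in the exponent, then for the product of exponentials. Exponential moments of centred products
  thus reduce to those of squares; the centring \<open>d\<close> costs the factor
  \<open>exp c\<close>.\<close>

lemma exp_abs_mult_le:
  fixes c x y d :: real
  assumes c: "c > 0" and d: "\<bar>d\<bar> \<le> 1"
  shows "exp (c * \<bar>x * y - d\<bar>) \<le> exp c * ((exp (c * x\<^sup>2) + exp (c * y\<^sup>2)) / 2)"
proof -
  have "0 \<le> (\<bar>x\<bar> - \<bar>y\<bar>)\<^sup>2" by simp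
  hence "\<bar>x * y\<bar> \<le> (x\<^sup>2 + y\<^sup>2) / 2" by (simp add: power2_diff abs_mult)
  hence "\<bar>x * y - d\<bar> \<le> 1 + (x\<^sup>2 + y\<^sup>2) / 2" using d by linarith
  hence "c * \<bar>x * y - d\<bar> \<le> c * (1 + (x\<^sup>2 + y\<^sup>2) / 2)"
    using c by (intro mult_left_mono) auto
  hence "exp (c * \<bar>x * y - d\<bar>) \<le> exp (c * (1 + (x\<^sup>2 + y\<^sup>2) / 2))" by simp
  also have "\<dots> = exp c * (exp (c * x\<^sup>2 / 2) * exp (c * y\<^sup>2 / 2))"
    by (simp add: mult_exp_exp algebra_simps)
  also have "exp (c * x\<^sup>2 / 2) * exp (c * y\<^sup>2 / 2) \<le> (exp (c * x\<^sup>2) + exp (c * y\<^sup>2)) / 2"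
  proof -
    have "0 \<le> (exp (c * x\<^sup>2 / 2) - exp (c * y\<^sup>2 / 2))\<^sup>2" by simp
    thus ?thesis by (simp add: power2_diff flip: exp_double)
  qed
  finally show ?thesis by simp
qed

lemma sample_cov_index:
  assumes "A \<in> carrier_mat m n" "i < m" "j < m"
  shows "sample_cov n A $$ (i, j) = (\<Sum>k<n. A $$ (i, k) * A $$ (j, k)) / real n"
  using assms by (auto simp: sample_cov_def scalar_prod_def lessThan_atLeast0)

lemma sample_cov_carrier:
  assumes "A \<in> carrier_mat m n"
  shows "sample_cov n A \<in> carrier_mat m m"
  using assms by (auto simp: sample_cov_def)

text \<open>Up to the factor \<open>n\<close>, the centred entry is a sum over the columns
  \<open>k\<close> of independent mean-zero variables \<open>Z k\<close>. Their exponential moments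
  are bounded in terms of \<mu> and \<open>c\<close> only, so \<open>indep_sum_tail\<close> gives a
  constant free of \<open>n\<close>, \<open>i\<close> and \<open>j\<close>.\<close>

lemma (in prob_space) sample_cov_entry_tail:
  fixes X :: "'a \<Rightarrow> real mat" and a :: real
  assumes law: "real_distribution \<mu>"
    and c: "c > 0" and int: "integrable \<mu> (\<lambda>x. exp (c * x\<^sup>2))"
    and mean: "(\<integral>x. x \<partial>\<mu>) = 0" and second: "(\<integral>x. x\<^sup>2 \<partial>\<mu>) = 1"
    and dim: "\<And>\<omega>. \<omega> \<in> space M \<Longrightarrow> X \<omega> \<in> carrier_mat m n"
    and indep: "indep_vars (\<lambda>_. borel) (\<lambda>(i, j) \<omega>. X \<omega> $$ (i, j)) ({..<m} \<times> {..<n})"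
    and ident: "\<And>i j. i < m \<Longrightarrow> j < n \<Longrightarrow> distr M borel (\<lambda>\<omega>. X \<omega> $$ (i, j)) = \<mu>"
    and n: "real n \<ge> 4 / c\<^sup>2" and ij: "i < m" "j < m"
  defines "E \<equiv> {\<omega> \<in> space M. \<bar>sample_cov n (X \<omega>) $$ (i, j) - of_bool (i = j)\<bar> * sqrt n \<ge> a}"
  shows "E \<in> events"
    and "prob E \<le> 2 * exp (4 * (exp c * (\<integral>x. exp (c * x\<^sup>2) \<partial>\<mu>)) / c\<^sup>2) * exp (- a)"
proof -
  interpret mu: real_distribution \<mu> by fact
  have X [measurable]: "(\<lambda>\<omega>. X \<omega> $$ (p, k)) \<in> borel_measurable M" if "p < m" "k < n" for p k
  proof -
    have "(p, k) \<in> {..<m} \<times> {..<n}" using that by simp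
    thus ?thesis using indep unfolding indep_vars_def by fastforce
  qed
  have transfer: "integrable M (\<lambda>\<omega>. f (X \<omega> $$ (p, k))) \<longleftrightarrow> integrable \<mu> f"
    "expectation (\<lambda>\<omega>. f (X \<omega> $$ (p, k))) = (\<integral>x. f x \<partial>\<mu>)"
    if "p < m" "k < n" "f \<in> borel_measurable borel" for p k and f :: "real \<Rightarrow> real"
    by (metis integrable_distr_eq[OF X[OF that(1,2)] that(3)] ident[OF that(1,2)])
      (metis integral_distr[OF X[OF that(1,2)] that(3)] ident[OF that(1,2)])
  \<comment> \<open>the integral of a non-integrable function is 0\<close>
  have int2: "integrable \<mu> (\<lambda>x. x\<^sup>2)"
    using second not_integrable_integral_eq[of \<mu> "\<lambda>x. x\<^sup>2"] by auto
  have int1: "integrable \<mu> (\<lambda>x. x)"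
    by (rule mu.square_integrable_imp_integrable[OF _ int2]) simp
  define d where "d = (of_bool (i = j) :: real)"
  define Z where "Z k \<omega> = X \<omega> $$ (i, k) * X \<omega> $$ (j, k) - d" for k \<omega>
  \<comment> \<open>\<open>Z k\<close> reads only the entries of column \<open>k\<close> at these
    indices. The sets are disjoint for distinct \<open>k\<close>, also when \<open>i = j\<close>
    collapses each to a singleton, so independence passes to the \<open>Z k\<close>.\<close>
  let ?K = "\<lambda>k. {(i, k), (j, k)}"
  have "indep_vars (\<lambda>k. PiM (?K k) (\<lambda>_. borel))
      (\<lambda>k \<omega>. restrict (\<lambda>p. (case p of (i, j) \<Rightarrow> \<lambda>\<omega>. X \<omega> $$ (i, j)) \<omega>) (?K k)) {..<n}"
    using ij by (intro indep_vars_restrict[OF indep]) (auto simp: disjoint_family_on_def)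
  hence "indep_vars (\<lambda>_. borel) (\<lambda>k \<omega>. (\<lambda>g. g (i, k) * g (j, k) - d)
      (restrict (\<lambda>p. (case p of (i, j) \<Rightarrow> \<lambda>\<omega>. X \<omega> $$ (i, j)) \<omega>) (?K k))) {..<n}"
    by (rule indep_vars_compose2) measurable
  hence indZ: "indep_vars (\<lambda>_. borel) Z {..<n}"
    by (simp add: Z_def [abs_def])
  have boundZ: "exp (c * \<bar>Z k \<omega>\<bar>)
      \<le> exp c * ((exp (c * (X \<omega> $$ (i, k))\<^sup>2) + exp (c * (X \<omega> $$ (j, k))\<^sup>2)) / 2)" for k \<omega>
    unfolding Z_def by (rule exp_abs_mult_le[OF c]) (simp add: d_def)
  have int_bound: "integrable M (\<lambda>\<omega>. exp c *
      ((exp (c * (X \<omega> $$ (i, k))\<^sup>2) + exp (c * (X \<omega> $$ (j, k))\<^sup>2)) / 2))" if "k < n" for k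
    using transfer(1)[of _ k "\<lambda>x. exp (c * x\<^sup>2)"] ij that int by simp
  have intZ: "integrable M (\<lambda>\<omega>. exp (c * \<bar>Z k \<omega>\<bar>))" if k: "k < n" for k
    using k ij boundZ
    by (intro Bochner_Integration.integrable_bound[OF int_bound[OF k]]) (auto simp: Z_def)
  have DZ: "expectation (\<lambda>\<omega>. exp (c * \<bar>Z k \<omega>\<bar>)) \<le> exp c * (\<integral>x. exp (c * x\<^sup>2) \<partial>\<mu>)"
    if k: "k < n" for k
  proof -
    have "expectation (\<lambda>\<omega>. exp (c * \<bar>Z k \<omega>\<bar>)) \<le> expectation (\<lambda>\<omega>. exp c *
      ((exp (c * (X \<omega> $$ (i, k))\<^sup>2) + exp (c * (X \<omega> $$ (j, k))\<^sup>2)) / 2))"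
      by (intro integral_mono intZ int_bound k boundZ)
    also have "\<dots> = exp c * (\<integral>x. exp (c * x\<^sup>2) \<partial>\<mu>)"
      using transfer[of _ k "\<lambda>x. exp (c * x\<^sup>2)"] ij k int by simp
    finally show ?thesis .
  qed
  \<comment> \<open>On the diagonal this is the unit second moment minus 1; off the diagonal,
    independence factors the expectation into two means, both 0.\<close>
  have meanZ: "expectation (Z k) = 0" if k: "k < n" for k
  proof (cases "i = j")
    case True
    thus ?thesis
      using transfer[of i k "\<lambda>x. x\<^sup>2"] ij k int2 second
      by (simp add: Z_def [abs_def] d_def prob_space flip: power2_eq_square)
  next
    case False
    let ?W = "\<lambda>(p, k) \<omega>. X \<omega> $$ (p, k)"
    have ind2: "indep_vars (\<lambda>_. borel) ?W (?K k)"
      by (rule indep_vars_subset[OF indep]) (use ij k in auto)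
    have int2': "integrable M (?W q)" if "q \<in> ?K k" for q
    proof -
      obtain p where p: "q = (p, k)" "p < m" using \<open>q \<in> ?K k\<close> ij by blast
      have "integrable M (\<lambda>\<omega>. X \<omega> $$ (p, k))"
        by (rule transfer(1)[OF p(2) k, THEN iffD2, OF _ int1]) simp
      thus ?thesis by (simp add: p(1))
    qed
    have "expectation (\<lambda>\<omega>. \<Prod>q\<in>?K k. ?W q \<omega>) = (\<Prod>q\<in>?K k. expectation (?W q))"
      by (rule indep_vars_lebesgue_integral[OF _ ind2 int2']) auto
    thus ?thesis
      using False transfer(2)[of i k "\<lambda>x. x"] ij k mean by (simp add: Z_def [abs_def] d_def)
  qed
  have n0: "n > 0" using n c by (cases n) (auto simp: field_simps)
  have scale: "\<bar>S / real n - d\<bar> * sqrt n \<ge> a \<longleftrightarrow> \<bar>S - real n * d\<bar> \<ge> a * sqrt n" for S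
  proof -
    have "\<bar>S / real n - d\<bar> * sqrt n * sqrt n = \<bar>S / real n - d\<bar> * real n"
      by (simp add: mult.assoc)
    also have "\<dots> = \<bar>(S / real n - d) * real n\<bar>" by (simp add: abs_mult)
    also have "(S / real n - d) * real n = S - real n * d" using n0 by (simp add: field_simps)
    finally have "\<bar>S / real n - d\<bar> * sqrt n * sqrt n = \<bar>S - real n * d\<bar>" .
    thus ?thesis using n0 by (metis mult_le_cancel_right_pos of_nat_0_less_iff real_sqrt_gt_0_iff)
  qed
  have E: "E = {\<omega> \<in> space M. \<bar>\<Sum>k<n. Z k \<omega>\<bar> \<ge> a * sqrt n}"
  proof -
    have "sample_cov n (X \<omega>) $$ (i, j) = (\<Sum>k<n. X \<omega> $$ (i, k) * X \<omega> $$ (j, k)) / real n"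
      if "\<omega> \<in> space M" for \<omega>
      by (rule sample_cov_index[OF dim[OF that] ij])
    moreover have "(\<Sum>k<n. Z k \<omega>) = (\<Sum>k<n. X \<omega> $$ (i, k) * X \<omega> $$ (j, k)) - real n * d" for \<omega>
      by (simp add: Z_def sum_subtractf)
    ultimately show ?thesis
      unfolding E_def d_def[symmetric] by (intro Collect_cong conj_cong refl) (simp only: scale)
  qed
  have [measurable]: "Z k \<in> borel_measurable M" if "k < n" for k
    using that indZ by (auto simp: indep_vars_def)
  show "E \<in> events" unfolding E by measurable
  show "prob E \<le> 2 * exp (4 * (exp c * (\<integral>x. exp (c * x\<^sup>2) \<partial>\<mu>)) / c\<^sup>2) * exp (- a)"
    unfolding E by (rule indep_sum_tail[OF indZ c n intZ DZ meanZ])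
qed

section \<open>Deterministic eigenvalue bounds for the entrywise power\<close>

text \<open>The two kinds of entries need different precision: on the diagonal a fixed
  \<open>d\<close> from continuity of the power at 1, off the diagonal a threshold \<open>t\<close>
  whose power is multiplied by the dimension \<open>m\<close>.\<close>

lemma abs_powr_mat_sample_cov_eigenvalues:
  fixes A :: "real mat"
  assumes A: "A \<in> carrier_mat m n" and m: "m > 0"
    and \<alpha>: "\<alpha> > 0" and t: "t \<ge> 0"
    and d: "\<And>x. \<bar>x - 1\<bar> < d \<Longrightarrow> \<bar>\<bar>x\<bar> powr \<alpha> - 1\<bar> < \<delta>"
    and entries: "\<And>i j. i < m \<Longrightarrow> j < m \<Longrightarrow>
      \<bar>sample_cov n A $$ (i, j) - of_bool (i = j)\<bar> < (if i = j then d else t)"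
  shows "min_eigenvalue (abs_powr_mat \<alpha> (sample_cov n A)) > 1 - (\<delta> + m * t powr \<alpha>)"
    and "max_eigenvalue (abs_powr_mat \<alpha> (sample_cov n A)) < 1 + (\<delta> + m * t powr \<alpha>)"
proof -
  note C = sample_cov_carrier[OF A]
  have B: "abs_powr_mat \<alpha> (sample_cov n A) \<in> carrier_mat m m"
    using C by (simp add: abs_powr_mat_def)
  have entry: "abs_powr_mat \<alpha> (sample_cov n A) $$ (i, j) = \<bar>sample_cov n A $$ (i, j)\<bar> powr \<alpha>"
    if "i < m" "j < m" for i j
    using that C by (auto simp: abs_powr_mat_def)
  have sym: "abs_powr_mat \<alpha> (sample_cov n A) $$ (i, j) = abs_powr_mat \<alpha> (sample_cov n A) $$ (j, i)"
    if "i < m" "j < m" for i j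
    using that by (simp add: entry sample_cov_index[OF A] mult.commute)
  have diag: "\<bar>abs_powr_mat \<alpha> (sample_cov n A) $$ (i, i) - 1\<bar> < \<delta>" if "i < m" for i
    using that entries[of i i] by (auto simp: entry intro!: d)
  have off: "\<bar>abs_powr_mat \<alpha> (sample_cov n A) $$ (i, j)\<bar> \<le> t powr \<alpha>"
    if "i < m" "j < m" "i \<noteq> j" for i j
    using that entries[of i j] \<alpha> by (auto simp: entry intro!: powr_mono2)
  show "min_eigenvalue (abs_powr_mat \<alpha> (sample_cov n A)) > 1 - (\<delta> + m * t powr \<alpha>)"
    and "max_eigenvalue (abs_powr_mat \<alpha> (sample_cov n A)) < 1 + (\<delta> + m * t powr \<alpha>)"
    using eigenvalues_near_one[OF B m sym diag off] by auto
qed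

section \<open>Choice of thresholds, union bound and passage to the limit\<close>

theorem proposition3:
  fixes s \<alpha> \<epsilon> :: real
    and \<mu> :: "real measure"
    and M :: "nat \<Rightarrow> 'a measure"
    and X :: "nat \<Rightarrow> 'a \<Rightarrow> real mat"
  assumes s: "0 < s" "s \<le> 1"
    and law: "real_distribution \<mu>"
    and sub_gaussian: "sub_gaussian \<mu> (\<lambda>x. x)"
    and mean: "prob_space.expectation \<mu> (\<lambda>x. x) = 0"
    and variance: "prob_space.variance \<mu> (\<lambda>x. x) = 1"
    and prob: "\<And>n. prob_space (M n)"
    and dim: "\<And>n \<omega>. \<omega> \<in> space (M n) \<Longrightarrow> X n \<omega> \<in> carrier_mat (row_dim s n) n"
    and indep: "\<And>n. prob_space.indep_vars (M n) (\<lambda>_. borel)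
                  (\<lambda>(i, j) \<omega>. X n \<omega> $$ (i, j)) ({..<row_dim s n} \<times> {..<n})"
    and ident: "\<And>n i j. i < row_dim s n \<Longrightarrow> j < n \<Longrightarrow>
                  distr (M n) borel (\<lambda>\<omega>. X n \<omega> $$ (i, j)) = \<mu>"
    and \<alpha>: "\<alpha> > 2 * s"
    and \<epsilon>: "\<epsilon> > 0"
  shows "((\<lambda>n. measure (M n) {\<omega> \<in> space (M n).
             min_eigenvalue (abs_powr_mat \<alpha> (sample_cov n (X n \<omega>))) \<le> 1 - \<epsilon>})
           \<longlonglongrightarrow> 0) \<and>
         ((\<lambda>n. measure (M n) {\<omega> \<in> space (M n).
             max_eigenvalue (abs_powr_mat \<alpha> (sample_cov n (X n \<omega>))) \<ge> 1 + \<epsilon>})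
           \<longlonglongrightarrow> 0)"
proof -
  obtain c where c: "c > 0" and int: "integrable \<mu> (\<lambda>x. exp (c * x\<^sup>2))"
    using sub_gaussian_exp_square_integrable[OF law sub_gaussian] by blast
  have second: "(\<integral>x. x\<^sup>2 \<partial>\<mu>) = 1" using variance mean by simp
  have \<alpha>0: "\<alpha> > 0" using \<alpha> s by simp
  have "isCont (\<lambda>x. \<bar>x\<bar> powr \<alpha>) (1::real)" by (intro continuous_intros) auto
  then obtain d where d: "d > 0" and near: "\<And>x. \<bar>x - 1\<bar> < d \<Longrightarrow> \<bar>\<bar>x\<bar> powr \<alpha> - 1\<bar> < \<epsilon> / 2"
    using \<epsilon> unfolding continuous_at_eps_delta dist_real_def
    by (metis abs_one half_gt_zero powr_one_eq_one)
  \<comment> \<open>Chosen so that \<open>real n powr s * t n powr \<alpha>\<close> is \<epsilon> /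
    2 for positive \<open>n\<close>; the other half of \<epsilon> goes to the diagonal.\<close>
  define \<kappa> where "\<kappa> = (\<epsilon> / 2) powr (1 / \<alpha>)"
  \<comment> \<open>The exponent left after multiplying the threshold \<open>t n\<close> by
    \<open>sqrt n\<close>; it is positive exactly because \<alpha> > 2 * s.\<close>
  define \<gamma> where "\<gamma> = 1 / 2 - s / \<alpha>"
  define t where "t n = \<kappa> * real n powr (- (s / \<alpha>))" for n
  define L where "L = 2 * exp (4 * (exp c * (\<integral>x. exp (c * x\<^sup>2) \<partial>\<mu>)) / c\<^sup>2)"
  \<comment> \<open>A union bound over at most \<open>n\<^sup>2\<close> entries, each charged with
    both the diagonal and the off-diagonal tail.\<close>
  define b where "b n = (real n)\<^sup>2 * L * exp (- (d * sqrt n)) + (real n)\<^sup>2 * L * exp (- (\<kappa> * real n powr \<gamma>))"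
    for n
  have \<kappa>: "\<kappa> > 0" using \<epsilon> by (simp add: \<kappa>_def)
  have \<gamma>: "\<gamma> > 0" using \<alpha> \<alpha>0 by (simp add: \<gamma>_def field_simps)
  have "((\<lambda>x::real. x\<^sup>2 * L * exp (- (d * sqrt x))) \<longlongrightarrow> 0) at_top"
    using d by real_asymp
  moreover have "((\<lambda>x::real. x\<^sup>2 * L * exp (- (\<kappa> * x powr \<gamma>))) \<longlongrightarrow> 0) at_top"
    using \<kappa> \<gamma> by real_asymp
  ultimately have b_lim: "b \<longlonglongrightarrow> 0"
    unfolding b_def
    by (intro tendsto_add_zero; elim filterlim_compose[OF _ filterlim_real_sequentially])
  \<comment> \<open>Both events of the theorem are instances of \<open>P\<close>. The event is only
    compared with a measurable union containing it, so measurability of the eigenvalues never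
    enters.\<close>
  have bad: "measure (M n) {\<omega> \<in> space (M n). P \<omega>} \<le> b n"
    if n: "n \<ge> 1" "real n \<ge> 4 / c\<^sup>2"
      and P: "\<And>\<omega>. \<omega> \<in> space (M n) \<Longrightarrow> P \<omega> \<Longrightarrow>
        min_eigenvalue (abs_powr_mat \<alpha> (sample_cov n (X n \<omega>))) \<le> 1 - \<epsilon> \<or>
        max_eigenvalue (abs_powr_mat \<alpha> (sample_cov n (X n \<omega>))) \<ge> 1 + \<epsilon>" for n P
  proof -
    interpret prob_space "M n" by (rule prob)
    let ?m = "row_dim s n"
    \<comment> \<open>Guarantees at least one row after rounding down, so that the extreme
      eigenvalues are meaningful.\<close>
    have "1 \<le> real n powr s" using n s by (intro ge_one_powr_ge_zero) auto
    hence m: "?m > 0" "real ?m \<le> real n powr s"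
      by (auto simp: row_dim_def of_nat_nat)
    have "real n powr s \<le> real n powr 1" using n s by (intro powr_mono) auto
    hence mn: "real ?m \<le> real n" using m n by simp
    have "t n powr \<alpha> = \<epsilon> / 2 * real n powr (- s)"
      using \<epsilon> \<alpha>0 by (simp add: t_def \<kappa>_def powr_mult powr_powr)
    hence "real ?m * t n powr \<alpha> \<le> real n powr s * (\<epsilon> / 2 * real n powr (- s))"
      using m(2) \<epsilon> by (simp only:) (intro mult_right_mono, auto)
    also have "\<dots> = \<epsilon> / 2" using n by (simp add: powr_minus)
    finally have mt: "real ?m * t n powr \<alpha> \<le> \<epsilon> / 2" .
    have t0: "t n \<ge> 0" using \<kappa> by (simp add: t_def)
    define a where "a i j = (if i = j then d else t n) * sqrt n" for i j :: nat
    define E where "E i j = {\<omega> \<in> space (M n).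
      \<bar>sample_cov n (X n \<omega>) $$ (i, j) - of_bool (i = j)\<bar> * sqrt n \<ge> a i j}" for i j
    have tail: "E i j \<in> events" "prob (E i j) \<le> L * exp (- a i j)" if "i < ?m" "j < ?m" for i j
      unfolding E_def L_def
      by (rule sample_cov_entry_tail[OF law c int mean second dim indep ident n(2) that]; assumption)+
    \<comment> \<open>Outside every \<open>E i j\<close> all entries meet the strict bounds of the
      deterministic lemma, which puts the smallest eigenvalue above 1 - \<epsilon> and the largest
      below 1 + \<epsilon>, against \<open>P\<close>.\<close>
    have sub: "{\<omega> \<in> space (M n). P \<omega>} \<subseteq> (\<Union>p\<in>{..<?m} \<times> {..<?m}. E (fst p) (snd p))"
    proof (rule ccontr)
      assume "\<not> ?thesis"
      then obtain \<omega> where \<omega>: "\<omega> \<in> space (M n)" "P \<omega>"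
        and notin: "\<And>i j. i < ?m \<Longrightarrow> j < ?m \<Longrightarrow> \<omega> \<notin> E i j" by force
      have "\<bar>sample_cov n (X n \<omega>) $$ (i, j) - of_bool (i = j)\<bar> < (if i = j then d else t n)"
        if "i < ?m" "j < ?m" for i j
        using notin[OF that] \<omega>(1) n(1) unfolding E_def a_def by (auto simp: mult_le_cancel_right)
      from abs_powr_mat_sample_cov_eigenvalues[OF dim[OF \<omega>(1)] m(1) \<alpha>0 t0 near this] P[OF \<omega>] mt
      show False by linarith
    qed
    have b_entry: "L * exp (- a i j) \<le> L * exp (- (d * sqrt n)) + L * exp (- (\<kappa> * real n powr \<gamma>))" for i j
    proof -
      have "t n * sqrt n = \<kappa> * (real n powr (- (s / \<alpha>)) * real n powr (1 / 2))"
        using n by (simp add: t_def powr_half_sqrt)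
      also have "\<dots> = \<kappa> * real n powr \<gamma>" by (simp add: \<gamma>_def flip: powr_add)
      finally show ?thesis by (simp add: a_def L_def)
    qed
    have ev: "(\<lambda>p. E (fst p) (snd p)) ` ({..<?m} \<times> {..<?m}) \<subseteq> events"
      by (auto intro: tail(1))
    have "prob {\<omega> \<in> space (M n). P \<omega>} \<le> prob (\<Union>p\<in>{..<?m} \<times> {..<?m}. E (fst p) (snd p))"
      by (intro finite_measure_mono sub sets.finite_UN) (auto intro: tail(1))
    also have "\<dots> \<le> (\<Sum>p\<in>{..<?m} \<times> {..<?m}. prob (E (fst p) (snd p)))"
      by (rule finite_measure_subadditive_finite[OF _ ev]) auto
    also have "\<dots> \<le> (\<Sum>p\<in>{..<?m} \<times> {..<?m}. L * exp (- (d * sqrt n)) + L * exp (- (\<kappa> * real n powr \<gamma>)))"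
      by (intro sum_mono order_trans[OF tail(2) b_entry]) auto
    also have "\<dots> = (real ?m)\<^sup>2 * (L * exp (- (d * sqrt n)) + L * exp (- (\<kappa> * real n powr \<gamma>)))"
      by (simp add: power2_eq_square)
    also have "\<dots> \<le> (real n)\<^sup>2 * (L * exp (- (d * sqrt n)) + L * exp (- (\<kappa> * real n powr \<gamma>)))"
      using mn by (intro mult_right_mono power_mono) (auto simp: L_def)
    also have "\<dots> = b n" by (simp add: b_def algebra_simps)
    finally show ?thesis .
  qed
  have large: "\<forall>\<^sub>F n in sequentially. n \<ge> 1 \<and> real n \<ge> 4 / c\<^sup>2"
    using filterlim_real_sequentially eventually_ge_at_top[of 1]
    by (auto simp: filterlim_at_top intro: eventually_conj)
  show ?thesis
  proof (intro conjI)
    show "(\<lambda>n. measure (M n) {\<omega> \<in> space (M n).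
             min_eigenvalue (abs_powr_mat \<alpha> (sample_cov n (X n \<omega>))) \<le> 1 - \<epsilon>}) \<longlonglongrightarrow> 0"
      by (rule tendsto_sandwich[OF _ _ tendsto_const b_lim])
        (use large in \<open>auto elim!: eventually_mono intro!: bad\<close>)
    show "(\<lambda>n. measure (M n) {\<omega> \<in> space (M n).
             max_eigenvalue (abs_powr_mat \<alpha> (sample_cov n (X n \<omega>))) \<ge> 1 + \<epsilon>}) \<longlonglongrightarrow> 0"
      by (rule tendsto_sandwich[OF _ _ tendsto_const b_lim])
        (use large in \<open>auto elim!: eventually_mono intro!: bad\<close>)
  qed
qed

end
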